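(* Let $A$ and $B$ be positive operators in $\mathbb{B}(\mathcal{H})$ and let $\alpha,\beta\in[0,1]$. If $0<sA\leq B\leq tA$ for some scalars $0<s\leq t$, then $$\lambda^{-1}(A\nabla_{\alpha}B)\leq A\sharp_{\beta}B\leq \mu\,(A!_{\alpha}B),$$ where $$\lambda=\max\{\,t^{-\beta}\nabla_{\alpha}t^{1-\beta},\ s^{-\beta}\nabla_{\alpha}s^{1-\beta}\,\}$$ and $$\mu=\max\{\,t^{\beta}\nabla_{\alpha}t^{-(1-\beta)},\ s^{\beta}\nabla_{\alpha}s^{-(1-\beta)}\,\}.$$
   Context: $\mathbb{B}(\mathcal{H})$ is the algebra of bounded linear operators on a complex Hilbert space $\mathcal{H}$. An operator $A$ is positive ($A\geq 0$) if $\langle Ax,x\rangle\geq 0$ for all $x\in\mathcal{H}$, and strictly positive ($A>0$) if it is positive and invertible. For self-adjoint $A,B$, $A\leq B$ means $B-A\geq 0$. In particular $0<sA\leq B\leq tA$ means that $sA$ is strictly positive, $sA\leq B$ and $B\leq tA$ (so $A,B>0$). For $A,B>0$ and $\alpha\in[0,1]$: $A\sharp_{\alpha}B=A^{1/2}(A^{-1/2}BA^{-1/2})^{\alpha}A^{1/2}$ (weighted geometric mean), $A\nabla_{\alpha}B=(1-\alpha)A+\alpha B$ (weighted arithmetic mean), $A!_{\alpha}B=((1-\alpha)A^{-1}+\alpha B^{-1})^{-1}$ (weighted harmonic mean). For positive scalars $a,b$, $a\nabla_{\alpha}b=(1-\alpha)a+\alpha b$. *)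

theory Defs
  imports "HOL-Analysis.Analysis" "HOL-Computational_Algebra.Polynomial"
begin

text \<open>
  Complex Hilbert spaces. The inner product is linear in the first argument. Completeness comes
  from \<^class>\<open>banach\<close>; the last axiom says that the norm is the one induced by the
  inner product, which also gives positive definiteness.
\<close>

class chilbert_space = banach +
  fixes scaleC :: "complex \<Rightarrow> 'a \<Rightarrow> 'a" (infixr "*\<^sub>C" 75)
    and cinner :: "'a \<Rightarrow> 'a \<Rightarrow> complex"
  assumes scaleC_of_real: "of_real r *\<^sub>C x = r *\<^sub>R x"
    and scaleC_add_right: "c *\<^sub>C (x + y) = c *\<^sub>C x + c *\<^sub>C y"
    and scaleC_add_left: "(c + d) *\<^sub>C x = c *\<^sub>C x + d *\<^sub>C x"
    and scaleC_scaleC: "c *\<^sub>C d *\<^sub>C x = (c * d) *\<^sub>C x"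
    and cinner_commute: "cinner x y = cnj (cinner y x)"
    and cinner_add_left: "cinner (x + y) z = cinner x z + cinner y z"
    and cinner_scaleC_left: "cinner (c *\<^sub>C x) y = c * cinner x y"
    and cinner_self: "cinner x x = of_real ((norm x)\<^sup>2)"

lemma cinner_scaleC_right: "cinner x (c *\<^sub>C y) = cnj c * cinner x y"
  for x y :: "'a::chilbert_space"
  by (metis cinner_commute cinner_scaleC_left complex_cnj_mult)

lemma norm_scaleC: "norm (c *\<^sub>C x) = cmod c * norm x" for x :: "'a::chilbert_space"
proof -
  have "complex_of_real ((norm (c *\<^sub>C x))\<^sup>2) = c * (cnj c * cinner x x)"
    by (simp only: cinner_self [symmetric] cinner_scaleC_left cinner_scaleC_right mult.left_commute)
  also have "\<dots> = (c * cnj c) * complex_of_real ((norm x)\<^sup>2)"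
    by (simp only: cinner_self mult.assoc)
  also have "\<dots> = complex_of_real ((cmod c * norm x)\<^sup>2)"
    by (simp only: complex_norm_square [symmetric] power_mult_distrib of_real_mult of_real_power)
  finally have "(norm (c *\<^sub>C x))\<^sup>2 = (cmod c * norm x)\<^sup>2"
    by (simp only: of_real_eq_iff)
  then show ?thesis
    by (simp add: power2_eq_iff_nonneg)
qed

instantiation complex :: chilbert_space
begin

definition scaleC_complex :: "complex \<Rightarrow> complex \<Rightarrow> complex"
  where "scaleC_complex c x = c * x"

definition cinner_complex :: "complex \<Rightarrow> complex \<Rightarrow> complex"
  where "cinner_complex x y = x * cnj y"

instance
proof
qed (simp_all add: scaleC_complex_def cinner_complex_def scaleR_conv_of_real
      complex_norm_square [symmetric] algebra_simps
      flip: of_real_power)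

end

text \<open>
  The library type \<open>'a \<Rightarrow>\<^sub>L 'a\<close> consists of the bounded \<^emph>\<open>real\<close>-linear maps with the operator
  norm; the algebra of bounded operators on the Hilbert space consists of its complex-linear elements.
\<close>

definition bounded_ops :: "('a::chilbert_space \<Rightarrow>\<^sub>L 'a) set"
  where "bounded_ops = {T :: 'a \<Rightarrow>\<^sub>L 'a. \<forall>c x. T (c *\<^sub>C x) = c *\<^sub>C T x}"

definition positive_op :: "('a::chilbert_space \<Rightarrow>\<^sub>L 'a) \<Rightarrow> bool"
  where "positive_op T \<longleftrightarrow> T \<in> bounded_ops \<and> (\<forall>x. cinner (T x) x \<in> \<real>\<^sub>\<ge>\<^sub>0)"

definition op_le :: "('a::chilbert_space \<Rightarrow>\<^sub>L 'a) \<Rightarrow> ('a \<Rightarrow>\<^sub>L 'a) \<Rightarrow> bool" (infix "\<le>\<^sub>o\<^sub>p" 50)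
  where "S \<le>\<^sub>o\<^sub>p T \<longleftrightarrow> positive_op (T - S)"

definition is_op_inverse :: "('a::chilbert_space \<Rightarrow>\<^sub>L 'a) \<Rightarrow> ('a \<Rightarrow>\<^sub>L 'a) \<Rightarrow> bool"
  where "is_op_inverse T S \<longleftrightarrow>
    S \<in> bounded_ops \<and> S o\<^sub>L T = id_blinfun \<and> T o\<^sub>L S = id_blinfun"

definition invertible_op :: "('a::chilbert_space \<Rightarrow>\<^sub>L 'a) \<Rightarrow> bool"
  where "invertible_op T \<longleftrightarrow> (\<exists>S. is_op_inverse T S)"

definition op_inverse :: "('a::chilbert_space \<Rightarrow>\<^sub>L 'a) \<Rightarrow> ('a \<Rightarrow>\<^sub>L 'a)"
  where "op_inverse T = (THE S. is_op_inverse T S)"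

definition strictly_positive_op :: "('a::chilbert_space \<Rightarrow>\<^sub>L 'a) \<Rightarrow> bool"
  where "strictly_positive_op T \<longleftrightarrow> positive_op T \<and> invertible_op T"

lift_definition scalar_op :: "complex \<Rightarrow> ('a::chilbert_space \<Rightarrow>\<^sub>L 'a)" is "\<lambda>c x. c *\<^sub>C x"
proof (rule bounded_linear_intro)
  fix c :: complex and x y :: 'a and r :: real
  show "c *\<^sub>C (x + y) = c *\<^sub>C x + c *\<^sub>C y"
    by (rule scaleC_add_right)
  show "c *\<^sub>C r *\<^sub>R x = r *\<^sub>R c *\<^sub>C x"
    by (simp add: scaleC_of_real [symmetric] scaleC_scaleC mult.commute)
  show "norm (c *\<^sub>C x) \<le> norm x * cmod c"
    by (simp add: norm_scaleC)
qed

definition spectrum :: "('a::chilbert_space \<Rightarrow>\<^sub>L 'a) \<Rightarrow> complex set"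
  where "spectrum T = {z. \<not> invertible_op (T - scalar_op z)}"

definition poly_op :: "real poly \<Rightarrow> ('a::chilbert_space \<Rightarrow>\<^sub>L 'a) \<Rightarrow> ('a \<Rightarrow>\<^sub>L 'a)"
  where "poly_op p T = (\<Sum>i\<le>degree p. coeff p i *\<^sub>R (((o\<^sub>L) T ^^ i) id_blinfun))"

text \<open>
  Continuous functional calculus of a self-adjoint operator \<open>T\<close> (whose spectrum is real) for a real
  function \<open>f\<close> continuous on the spectrum: \<open>f(T)\<close> is the norm limit of \<open>p\<^sub>n(T)\<close> for every sequence
  of polynomials \<open>p\<^sub>n\<close> converging to \<open>f\<close> uniformly on the spectrum of \<open>T\<close>. Outside this
  setting the value is unspecified.
\<close>

definition cfc :: "(real \<Rightarrow> real) \<Rightarrow> ('a::chilbert_space \<Rightarrow>\<^sub>L 'a) \<Rightarrow> ('a \<Rightarrow>\<^sub>L 'a)"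
  where "cfc f T = (THE S. \<forall>p.
    uniform_limit {x. complex_of_real x \<in> spectrum T} (\<lambda>n x. poly (p n) x) f sequentially \<longrightarrow>
    (\<lambda>n. poly_op (p n) T) \<longlonglongrightarrow> S)"

text \<open>Meant for strictly positive operators, whose spectrum lies in the positive half-line.\<close>

definition op_powr :: "('a::chilbert_space \<Rightarrow>\<^sub>L 'a) \<Rightarrow> real \<Rightarrow> ('a \<Rightarrow>\<^sub>L 'a)" (infixr "powr\<^sub>o\<^sub>p" 80)
  where "T powr\<^sub>o\<^sub>p r = cfc (\<lambda>x. x powr r) T"

text \<open>
  Weighted means. The arithmetic mean is used both for operators and for real numbers, where
  \<open>*\<^sub>R\<close> is multiplication.
\<close>

definition arith_mean :: "'a::real_vector \<Rightarrow> real \<Rightarrow> 'a \<Rightarrow> 'a" ("(_ \<nabla>\<^bsub>_\<^esub> _)" [66, 0, 66] 65)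
  where "A \<nabla>\<^bsub>\<alpha>\<^esub> B = (1 - \<alpha>) *\<^sub>R A + \<alpha> *\<^sub>R B"

definition geo_mean :: "('a::chilbert_space \<Rightarrow>\<^sub>L 'a) \<Rightarrow> real \<Rightarrow> ('a \<Rightarrow>\<^sub>L 'a) \<Rightarrow> ('a \<Rightarrow>\<^sub>L 'a)"
    ("(_ \<sharp>\<^bsub>_\<^esub> _)" [66, 0, 66] 65)
  where "A \<sharp>\<^bsub>\<alpha>\<^esub> B =
    A powr\<^sub>o\<^sub>p (1/2) o\<^sub>L
      (A powr\<^sub>o\<^sub>p (-1/2) o\<^sub>L B o\<^sub>L A powr\<^sub>o\<^sub>p (-1/2)) powr\<^sub>o\<^sub>p \<alpha> o\<^sub>L
    A powr\<^sub>o\<^sub>p (1/2)"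

definition harm_mean :: "('a::chilbert_space \<Rightarrow>\<^sub>L 'a) \<Rightarrow> real \<Rightarrow> ('a \<Rightarrow>\<^sub>L 'a) \<Rightarrow> ('a \<Rightarrow>\<^sub>L 'a)"
    ("(_ !\<^bsub>_\<^esub> _)" [66, 0, 66] 65)
  where "A !\<^bsub>\<alpha>\<^esub> B =
    op_inverse ((1 - \<alpha>) *\<^sub>R op_inverse A + \<alpha> *\<^sub>R op_inverse B)"

end

theory Submission
  imports Defs "HOL-Computational_Algebra.Fundamental_Theorem_Algebra"
begin

text \<open>
  A congruence reduces the theorem to an inequality between real functions. With
  \<open>X = A\<^sup>1\<^sup>/\<^sup>2\<close> and \<open>T = A\<^sup>-\<^sup>1\<^sup>/\<^sup>2 B A\<^sup>-\<^sup>1\<^sup>/\<^sup>2\<close>, the hypothesis becomes \<open>s \<le> T \<le> t\<close>, and the three means of \<open>A\<close> and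
  \<open>B\<close> are \<open>X f(T) X\<close> for the functions \<open>f\<close> giving the corresponding means of \<open>1\<close> and \<open>x\<close>: these are
  \<open>(1 - \<alpha>) + \<alpha> x\<close>, \<open>x\<^sup>\<beta>\<close> and \<open>1 / ((1 - \<alpha>) + \<alpha> / x)\<close> (for the harmonic mean, see
  \<open>harm_mean_congruence\<close>). Both congruence and functional calculus preserve inequalities
  (\<open>op_le_sandwich\<close>, \<open>cfc_mono\<close>), so it is enough to compare these functions on \<open>[s, t]\<close>. After division by
  \<open>x\<^sup>\<beta>\<close>, or multiplication by \<open>(1 - \<alpha>) + \<alpha> / x\<close>, one has to bound a weighted arithmetic mean of two powers
  of \<open>x\<close>. As a function of \<open>ln x\<close> it is convex, so its maximum over \<open>[s, t]\<close> is attained at \<open>s\<close> or \<open>t\<close>; these two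
  values are the ones in the definition of \<open>lam\<close> and of \<open>\<mu>\<close>.

  Most of the text builds the continuous functional calculus of a self-adjoint operator \<open>T\<close>. Its core is
  the estimate of \<open>\<parallel>p(T)\<parallel>\<close> by the supremum of \<open>\<bar>p\<bar>\<close> over the real points of the spectrum
  (\<open>norm_poly_op_le\<close>): it makes the limits in the definition of \<open>cfc\<close> exist and agree. The estimate
  combines two facts. If a polynomial \<open>q\<close> has no zero on the real spectrum, then \<open>q(T)\<close> is invertible
  (\<open>poly_op_invertible\<close>), by factorization over the reals and the Lax--Milgram lemma
  (\<open>coercive_invertible\<close>). And \<open>S\<^sup>2 - \<parallel>S\<parallel>\<^sup>2\<close> is never invertible for self-adjoint \<open>S\<close> on a nonzero space
  (\<open>norm_square_in_spectrum\<close>). Apply the first to \<open>q = p\<^sup>2 - \<parallel>p(T)\<parallel>\<^sup>2\<close> and the second to \<open>S = p(T)\<close>.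
\<close>

section \<open>The underlying real inner product\<close>

text \<open>
  The real part of the inner product makes the space a real inner product space with the same norm.
  For complex-linear maps, symmetry and positivity of the real form already imply the complex ones
  (apply the real statement to \<open>\<i> x\<close>), so everything below is computed with \<open>rip\<close>.
\<close>

definition rip :: "'a::chilbert_space \<Rightarrow> 'a \<Rightarrow> real"
  where "rip x y = Re (cinner x y)"

lemma rip_commute: "rip x y = rip y x"
  unfolding rip_def using cinner_commute[of x y] by simp

lemma rip_self: "rip x x = (norm x)\<^sup>2"
  by (simp add: rip_def cinner_self flip: of_real_power)

lemma rip_add_left: "rip (x + y) z = rip x z + rip y z"
  by (simp add: rip_def cinner_add_left)

lemma rip_scaleR_left: "rip (r *\<^sub>R x) y = r * rip x y"
  by (simp add: rip_def cinner_scaleC_left flip: scaleC_of_real)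

text \<open>
  Cauchy--Schwarz is the triangle inequality for \<open>x + y\<close>, squared: the norm is known to be one.
\<close>

lemma rip_le_norm: "rip x y \<le> norm x * norm y"
proof -
  have "(norm (x + y))\<^sup>2 \<le> (norm x + norm y)\<^sup>2"
    by (simp add: norm_triangle_ineq power_mono)
  moreover have "(norm (x + y))\<^sup>2 = (norm x)\<^sup>2 + 2 * rip x y + (norm y)\<^sup>2"
    using rip_commute[of y "x + y"] rip_commute[of x "x + y"] rip_commute[of x y]
    by (simp add: rip_add_left flip: rip_self)
  ultimately show ?thesis
    by (simp add: power2_sum)
qed

lemma bounded_bilinear_rip: "bounded_bilinear (rip :: 'a::chilbert_space \<Rightarrow> 'a \<Rightarrow> real)"
proof (rule bounded_bilinear.intro)
  fix x y z :: 'a and r :: real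
  show "rip (x + y) z = rip x z + rip y z"
    by (rule rip_add_left)
  show "rip x (y + z) = rip x y + rip x z"
    by (simp only: rip_commute[of x] rip_add_left)
  show "rip (r *\<^sub>R x) y = r *\<^sub>R rip x y"
    by (simp add: rip_scaleR_left)
  show "rip x (r *\<^sub>R y) = r *\<^sub>R rip x y"
    by (simp add: rip_commute[of x] rip_scaleR_left)
next
  have "norm (rip x y) \<le> norm x * norm y * 1" for x y :: 'a
    using rip_le_norm[of x y] rip_le_norm[of "- x" y] rip_scaleR_left[of "-1" x y]
    by (simp add: abs_le_iff)
  then show "\<exists>K. \<forall>x y :: 'a. norm (rip x y) \<le> norm x * norm y * K"
    by blast
qed

interpretation rip: bounded_bilinear rip
  by (rule bounded_bilinear_rip)

lemma norm_diff_square: "(norm (x - y))\<^sup>2 = (norm x)\<^sup>2 - 2 * rip x y + (norm y)\<^sup>2"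
  by (simp add: rip.diff_left rip.diff_right rip_commute[of y x] flip: rip_self)

interpretation comp: bounded_bilinear "(o\<^sub>L)"
  by (rule bounded_bilinear_blinfun_compose)

lemma blinfun_compose_assoc: "(S o\<^sub>L T) o\<^sub>L U = S o\<^sub>L (T o\<^sub>L U)"
  by (auto intro: blinfun_eqI)

lemma blinfun_compose_id [simp]: "id_blinfun o\<^sub>L T = T" "T o\<^sub>L id_blinfun = T"
  by (auto intro: blinfun_eqI)

section \<open>Complex-linear, self-adjoint and positive operators\<close>

lemma scaleC_scaleR: "c *\<^sub>C r *\<^sub>R x = r *\<^sub>R c *\<^sub>C x" for x :: "'a::chilbert_space"
  by (simp add: scaleC_of_real [symmetric] scaleC_scaleC mult.commute)

lemma bounded_opsD: "T \<in> bounded_ops \<Longrightarrow> T (c *\<^sub>C x) = c *\<^sub>C T x"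
  by (simp add: bounded_ops_def)

lemma bounded_ops_add: "S \<in> bounded_ops \<Longrightarrow> T \<in> bounded_ops \<Longrightarrow> S + T \<in> bounded_ops"
  by (simp add: bounded_ops_def blinfun.bilinear_simps scaleC_add_right)

lemma bounded_ops_scaleR: "T \<in> bounded_ops \<Longrightarrow> r *\<^sub>R T \<in> bounded_ops"
  by (simp add: bounded_ops_def blinfun.bilinear_simps scaleC_scaleR)

lemma bounded_ops_id: "id_blinfun \<in> bounded_ops"
  by (simp add: bounded_ops_def)

lemma bounded_ops_compose: "S \<in> bounded_ops \<Longrightarrow> T \<in> bounded_ops \<Longrightarrow> S o\<^sub>L T \<in> bounded_ops"
  by (simp add: bounded_ops_def)

definition self_adjoint :: "('a::chilbert_space \<Rightarrow>\<^sub>L 'a) \<Rightarrow> bool"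
  where "self_adjoint T \<longleftrightarrow> T \<in> bounded_ops \<and> (\<forall>x y. rip (T x) y = rip x (T y))"

lemma self_adjointD: "self_adjoint T \<Longrightarrow> rip (T x) y = rip x (T y)"
  by (simp add: self_adjoint_def)

lemma self_adjoint_id: "self_adjoint id_blinfun"
  by (simp add: self_adjoint_def bounded_ops_id)

lemma self_adjoint_add: "self_adjoint S \<Longrightarrow> self_adjoint T \<Longrightarrow> self_adjoint (S + T)"
  by (simp add: self_adjoint_def bounded_ops_add blinfun.bilinear_simps rip.add_left rip.add_right)

lemma self_adjoint_scaleR: "self_adjoint T \<Longrightarrow> self_adjoint (r *\<^sub>R T)"
  by (simp add: self_adjoint_def bounded_ops_scaleR blinfun.bilinear_simps rip.scaleR_left rip.scaleR_right)

lemma self_adjoint_diff: "self_adjoint S \<Longrightarrow> self_adjoint T \<Longrightarrow> self_adjoint (S - T)"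
  using self_adjoint_add[of S "(-1) *\<^sub>R T"] self_adjoint_scaleR[of T "-1"] by simp

lemma self_adjoint_sandwich: "self_adjoint S \<Longrightarrow> self_adjoint T \<Longrightarrow> self_adjoint (S o\<^sub>L T o\<^sub>L S)"
  by (simp add: self_adjoint_def bounded_ops_compose)

lemma self_adjoint_compose:
  "self_adjoint S \<Longrightarrow> self_adjoint T \<Longrightarrow> S o\<^sub>L T = T o\<^sub>L S \<Longrightarrow> self_adjoint (S o\<^sub>L T)"
  unfolding self_adjoint_def
  by (metis blinfun_apply_blinfun_compose bounded_ops_compose)

lemma self_adjoint_tendsto:
  assumes S: "\<And>n. self_adjoint (S n)" and lim: "S \<longlonglongrightarrow> T"
  shows "self_adjoint T"
proof -
  have pt: "(\<lambda>n. S n x) \<longlonglongrightarrow> T x" for x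
    by (intro tendsto_intros lim)
  have "T (c *\<^sub>C x) = c *\<^sub>C T x" for c x
  proof (rule LIMSEQ_unique[OF pt])
    have "(\<lambda>n. scalar_op c (S n x)) \<longlonglongrightarrow> scalar_op c (T x)"
      by (intro tendsto_intros pt)
    then show "(\<lambda>n. S n (c *\<^sub>C x)) \<longlonglongrightarrow> c *\<^sub>C T x"
      using S by (simp add: self_adjoint_def bounded_opsD scalar_op.rep_eq)
  qed
  moreover have "rip (T x) y = rip x (T y)" for x y
  proof (rule LIMSEQ_unique)
    show "(\<lambda>n. rip (S n x) y) \<longlonglongrightarrow> rip (T x) y"
      by (intro rip.tendsto pt tendsto_const)
    show "(\<lambda>n. rip (S n x) y) \<longlonglongrightarrow> rip x (T y)"
      using S by (simp add: self_adjointD, intro rip.tendsto pt tendsto_const)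
  qed
  ultimately show ?thesis
    by (simp add: self_adjoint_def bounded_ops_def)
qed

text \<open>
  For the direction from left to right, positivity makes \<open>\<langle>T z, z\<rangle>\<close> real; polarizing with
  \<open>z = x + \<i> y\<close> and taking imaginary parts gives the symmetry of the real form. Conversely, symmetry
  applied to \<open>\<i> x\<close> and \<open>x\<close> shows that \<open>\<langle>T x, x\<rangle>\<close> has no imaginary part.
\<close>

lemma positive_op_iff: "positive_op T \<longleftrightarrow> self_adjoint T \<and> (\<forall>x. 0 \<le> rip (T x) x)"
proof (intro iffI conjI allI)
  assume T: "positive_op T"
  then show "0 \<le> rip (T x) x" for x
    by (simp add: positive_op_def rip_def complex_nonneg_Reals_iff)
  have lin: "T \<in> bounded_ops" and im: "Im (cinner (T x) x) = 0" for x
    using T by (simp_all add: positive_op_def complex_nonneg_Reals_iff)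
  have "rip (T x) y = rip x (T y)" for x y
  proof -
    have "T (x + \<i> *\<^sub>C y) = T x + \<i> *\<^sub>C T y"
      using lin by (simp add: blinfun.add_right bounded_opsD)
    moreover have "cinner a (b + \<i> *\<^sub>C c) = cinner a b - \<i> * cinner a c" for a b c :: 'a
      by (metis (no_types, lifting) cinner_add_left cinner_commute cinner_scaleC_right
          complex_cnj_add complex_cnj_cnj complex_cnj_i diff_conv_add_uminus mult_minus_left)
    ultimately show ?thesis
      using im[of "x + \<i> *\<^sub>C y"] im[of x] im[of y] cinner_commute[of x "T y"]
      by (simp add: cinner_add_left cinner_scaleC_left rip_def)
  qed
  with lin show "self_adjoint T"
    by (simp add: self_adjoint_def)
next
  assume T: "self_adjoint T \<and> (\<forall>x. 0 \<le> rip (T x) x)"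
  have "Im (cinner (T x) x) = 0" for x
  proof -
    have "rip (T (\<i> *\<^sub>C x)) x = rip (\<i> *\<^sub>C x) (T x)"
      using T by (simp add: self_adjointD)
    then show ?thesis
      using T arg_cong[OF cinner_commute[of x "T x"], of Im]
      by (simp add: rip_def self_adjoint_def bounded_opsD cinner_scaleC_left)
  qed
  with T show "positive_op T"
    by (auto simp: positive_op_def self_adjoint_def rip_def complex_nonneg_Reals_iff)
qed

lemma op_leI:
  assumes "self_adjoint S" "self_adjoint T" "\<And>x. rip (S x) x \<le> rip (T x) x"
  shows "S \<le>\<^sub>o\<^sub>p T"
  using assms by (simp add: op_le_def positive_op_iff self_adjoint_diff blinfun.bilinear_simps rip.diff_left)

lemma op_leD: "S \<le>\<^sub>o\<^sub>p T \<Longrightarrow> rip (S x) x \<le> rip (T x) x"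
  by (simp add: op_le_def positive_op_iff blinfun.bilinear_simps rip.diff_left)

text \<open>
  The operator inequality \<open>A\<^sup>2 \<le> M A\<close>. The form of \<open>A\<close> is nonnegative at \<open>M x - A x\<close>, and
  expanding it leaves \<open>M\<close> times the claim once \<open>\<langle>A (A x), A x\<rangle>\<close> is bounded by \<open>M \<parallel>A x\<parallel>\<^sup>2\<close>.
\<close>

lemma positive_op_square_le:
  assumes "positive_op A"
  shows "\<exists>M>0. \<forall>x. (norm (A x))\<^sup>2 \<le> M * rip (A x) x"
proof (intro exI conjI allI)
  define M where "M = norm A + 1"
  show M: "M > 0"
    by (simp add: M_def add_nonneg_pos)
  fix x
  let ?y = "A x"
  have "rip (A ?y) ?y \<le> norm (A ?y) * norm ?y"
    by (rule rip_le_norm)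
  also have "\<dots> \<le> (M * norm ?y) * norm ?y"
    by (intro mult_right_mono order_trans[OF norm_blinfun])
      (auto simp: M_def intro: mult_right_mono)
  finally have AA: "rip (A ?y) ?y \<le> M * (norm ?y)\<^sup>2"
    by (simp add: power2_eq_square)
  have "0 \<le> rip (A (M *\<^sub>R x - ?y)) (M *\<^sub>R x - ?y)"
    using assms by (simp add: positive_op_iff)
  also have "\<dots> = M\<^sup>2 * rip ?y x - 2 * M * (norm ?y)\<^sup>2 + rip (A ?y) ?y"
    using assms self_adjointD[of A ?y x]
    by (simp add: positive_op_iff blinfun.bilinear_simps rip.diff_left rip.diff_right
        rip.scaleR_left rip.scaleR_right rip_self[symmetric] power2_eq_square[of M] algebra_simps)
  finally have "0 \<le> M * (M * rip ?y x - (norm ?y)\<^sup>2)"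
    using AA by (simp add: power2_eq_square algebra_simps)
  then show "(norm ?y)\<^sup>2 \<le> M * rip ?y x"
    using M by (simp add: zero_le_mult_iff)
qed

section \<open>Invertibility\<close>

lemma is_op_inverse_unique: "is_op_inverse T S \<Longrightarrow> is_op_inverse T S' \<Longrightarrow> S = S'"
  unfolding is_op_inverse_def by (metis blinfun_compose_assoc blinfun_compose_id)

lemma op_inverse_eqI: "is_op_inverse T S \<Longrightarrow> op_inverse T = S"
  unfolding op_inverse_def using is_op_inverse_unique by blast

lemma is_op_inverse_compose:
  assumes "is_op_inverse S S'" "is_op_inverse T T'"
  shows "is_op_inverse (S o\<^sub>L T) (T' o\<^sub>L S')"
  using assms unfolding is_op_inverse_def
  by (metis blinfun_compose_assoc blinfun_compose_id bounded_ops_compose)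

lemma invertible_op_compose: "invertible_op S \<Longrightarrow> invertible_op T \<Longrightarrow> invertible_op (S o\<^sub>L T)"
  unfolding invertible_op_def using is_op_inverse_compose by blast

lemma is_op_inverse_scaleR_id: "a \<noteq> 0 \<Longrightarrow> is_op_inverse (a *\<^sub>R id_blinfun) (inverse a *\<^sub>R id_blinfun)"
  by (auto simp: is_op_inverse_def bounded_ops_scaleR bounded_ops_id comp.scaleR_left comp.scaleR_right)

lemma invertible_op_scaleR: "a \<noteq> 0 \<Longrightarrow> invertible_op T \<Longrightarrow> invertible_op (a *\<^sub>R T)"
  using invertible_op_compose[of "a *\<^sub>R id_blinfun" T] is_op_inverse_scaleR_id[of a]
  by (auto simp: invertible_op_def comp.scaleR_left)

lemma invertible_op_bounded_below:
  assumes "invertible_op T"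
  shows "\<exists>k>0. \<forall>x. k * norm x \<le> norm (T x)"
proof -
  obtain S where S: "S o\<^sub>L T = id_blinfun"
    using assms by (auto simp: invertible_op_def is_op_inverse_def)
  define K where "K = norm S + 1"
  have K: "K > 0"
    by (simp add: K_def add_nonneg_pos)
  have "norm x \<le> K * norm (T x)" for x
  proof -
    have "x = S (T x)"
      by (metis S blinfun_apply_blinfun_compose blinfun_apply_id_blinfun)
    then have "norm x \<le> norm S * norm (T x)"
      by (metis norm_blinfun)
    also have "\<dots> \<le> K * norm (T x)"
      by (simp add: K_def mult_right_mono)
    finally show ?thesis .
  qed
  then have "\<forall>x. inverse K * norm x \<le> norm (T x)"
    using K by (simp add: field_simps)
  with K show ?thesis
    by (metis inverse_positive_iff_positive)
qed

text \<open>
  The lower bound makes the set-theoretic inverse single-valued and bounded; linearity over the reals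
  and over the complex numbers is inherited from \<open>T\<close>.
\<close>

lemma invertible_opI:
  assumes lin: "T \<in> bounded_ops" and "k > 0"
    and below: "\<And>x. k * norm x \<le> norm (T x)" and onto: "\<And>y. \<exists>x. T x = y"
  shows "invertible_op T"
proof -
  have inj: "x = y" if "T x = T y" for x y
    using below[of "x - y"] that \<open>k > 0\<close> by (simp add: blinfun.diff_right mult_le_0_iff)
  define g where "g = inv (blinfun_apply T)"
  have Tg: "T (g y) = y" for y
    unfolding g_def using onto by (metis f_inv_into_f rangeI)
  have "bounded_linear g"
  proof (rule bounded_linear_intro)
    show "g (x + y) = g x + g y" for x y
      by (rule inj) (simp add: blinfun.bilinear_simps Tg)
    show "g (r *\<^sub>R x) = r *\<^sub>R g x" for r x
      by (rule inj) (simp add: blinfun.bilinear_simps Tg)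
    show "norm (g x) \<le> norm x * inverse k" for x
      using below[of "g x"] \<open>k > 0\<close> by (simp add: Tg field_simps)
  qed
  then have G: "blinfun_apply (Blinfun g) = g"
    by (rule bounded_linear_Blinfun_apply)
  have "is_op_inverse T (Blinfun g)"
    unfolding is_op_inverse_def bounded_ops_def
  proof (intro conjI CollectI allI)
    show "Blinfun g (c *\<^sub>C x) = c *\<^sub>C Blinfun g x" for c x
      by (rule inj) (simp add: G Tg bounded_opsD[OF lin])
    show "Blinfun g o\<^sub>L T = id_blinfun"
      by (intro blinfun_eqI) (simp add: G Tg inj)
    show "T o\<^sub>L Blinfun g = id_blinfun"
      by (intro blinfun_eqI) (simp add: G Tg)
  qed
  then show ?thesis
    unfolding invertible_op_def by blast
qed

text \<open>
  The Lax--Milgram lemma. For a small step \<open>e > 0\<close> the map \<open>x \<mapsto> x - e (T x - y)\<close> is a contraction,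
  because coercivity beats the quadratic error term; its fixed point solves \<open>T x = y\<close>.
\<close>

lemma coercive_invertible:
  assumes lin: "T \<in> bounded_ops" and "c > 0" and coer: "\<And>x. c * (norm x)\<^sup>2 \<le> rip (T x) x"
  shows "invertible_op T"
proof (rule invertible_opI[OF lin \<open>c > 0\<close>])
  show "c * norm x \<le> norm (T x)" for x
  proof (cases "x = 0")
    case False
    have "c * norm x * norm x \<le> norm (T x) * norm x"
      using coer[of x] rip_le_norm[of "T x" x] by (simp add: power2_eq_square)
    with False show ?thesis by simp
  qed simp
  fix y
  define M where "M = norm T + c"
  have M: "M > 0" "c \<le> M" "norm T \<le> M"
    using \<open>c > 0\<close> by (auto simp: M_def add_nonneg_pos)
  \<comment> \<open>This step size minimizes \<open>1 - 2 e c + e\<^sup>2 M\<^sup>2\<close>, the bound for the squared contraction factor.\<close>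
  define e where "e = c / M\<^sup>2"
  have e: "e > 0" using M \<open>c > 0\<close> by (simp add: e_def)
  define q where "q = 1 - c\<^sup>2 / M\<^sup>2"
  have q: "0 \<le> q" "q < 1"
    using M \<open>c > 0\<close> by (auto simp: q_def power_mono)
  have contr: "norm (z - e *\<^sub>R T z) \<le> sqrt q * norm z" for z
  proof (rule power2_le_imp_le)
    have "norm (T z) \<le> M * norm z"
      by (rule order_trans[OF norm_blinfun]) (simp add: M mult_right_mono)
    then have "(norm (T z))\<^sup>2 \<le> M\<^sup>2 * (norm z)\<^sup>2"
      by (metis norm_ge_zero power_mono power_mult_distrib)
    then have 1: "e\<^sup>2 * (norm (T z))\<^sup>2 \<le> e\<^sup>2 * (M\<^sup>2 * (norm z)\<^sup>2)"
      by (simp add: mult_left_mono)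
    have 2: "2 * e * (c * (norm z)\<^sup>2) \<le> 2 * e * rip (T z) z"
      using coer[of z] e by simp
    have "(norm (z - e *\<^sub>R T z))\<^sup>2 = (norm z)\<^sup>2 - 2 * e * rip (T z) z + e\<^sup>2 * (norm (T z))\<^sup>2"
      by (simp add: norm_diff_square rip.scaleR_right rip_commute[of z "T z"] power_mult_distrib)
    also have "\<dots> \<le> (norm z)\<^sup>2 - 2 * e * (c * (norm z)\<^sup>2) + e\<^sup>2 * (M\<^sup>2 * (norm z)\<^sup>2)"
      using 1 2 by linarith
    also have "\<dots> = q * (norm z)\<^sup>2"
      using M by (simp add: q_def e_def power2_eq_square field_simps)
    finally show "(norm (z - e *\<^sub>R T z))\<^sup>2 \<le> (sqrt q * norm z)\<^sup>2"
      using q by (simp add: power_mult_distrib)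
  qed (use q in auto)
  define f where "f x = x - e *\<^sub>R (T x - y)" for x
  have "dist (f u) (f v) \<le> sqrt q * dist u v" for u v
    using contr[of "u - v"]
    by (simp add: f_def dist_norm blinfun.diff_right algebra_simps)
  then obtain x where "f x = x"
    using banach_fix_type[of "sqrt q" f] q by auto
  with e have "T x = y" by (simp add: f_def)
  then show "\<exists>x. T x = y" ..
qed

text \<open>
  Invertibility bounds \<open>\<parallel>A x\<parallel>\<close> from below by \<open>k \<parallel>x\<parallel>\<close>, and \<open>A\<^sup>2 \<le> M A\<close> carries this over to the form.
\<close>

lemma strictly_positive_coercive:
  assumes "strictly_positive_op A"
  shows "\<exists>c>0. \<forall>x. c * (norm x)\<^sup>2 \<le> rip (A x) x"
proof -
  obtain M where M: "M > 0" "\<And>x. (norm (A x))\<^sup>2 \<le> M * rip (A x) x"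
    using assms positive_op_square_le by (auto simp: strictly_positive_op_def)
  obtain k where k: "k > 0" "\<And>x. k * norm x \<le> norm (A x)"
    using assms invertible_op_bounded_below by (auto simp: strictly_positive_op_def)
  have "k\<^sup>2 / M * (norm x)\<^sup>2 \<le> rip (A x) x" for x
  proof -
    have "(k * norm x)\<^sup>2 \<le> (norm (A x))\<^sup>2"
      using k by (intro power_mono) auto
    with M(2)[of x] have "k\<^sup>2 * (norm x)\<^sup>2 \<le> M * rip (A x) x"
      by (simp add: power_mult_distrib)
    with M(1) show ?thesis by (simp add: field_simps)
  qed
  with M k show ?thesis by (intro exI[of _ "k\<^sup>2 / M"]) auto
qed

lemma scalar_op_of_real: "scalar_op (of_real r) = r *\<^sub>R id_blinfun"
  by (intro blinfun_eqI) (simp add: scalar_op.rep_eq scaleC_of_real blinfun.scaleR_left)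

text \<open>
  The set on which the definition of \<open>cfc\<close> tests uniform convergence.
\<close>

definition real_spectrum :: "('a::chilbert_space \<Rightarrow>\<^sub>L 'a) \<Rightarrow> real set"
  where "real_spectrum T = {x. complex_of_real x \<in> spectrum T}"

lemma real_spectrum_iff: "x \<in> real_spectrum T \<longleftrightarrow> \<not> invertible_op (T - x *\<^sub>R id_blinfun)"
  by (simp add: real_spectrum_def spectrum_def scalar_op_of_real)

text \<open>
  Outside \<open>[a, b]\<close> either \<open>T - r\<close> or its negative is coercive.
\<close>

lemma real_spectrum_subset:
  assumes T: "self_adjoint T"
    and lo: "\<And>x. a * (norm x)\<^sup>2 \<le> rip (T x) x" and hi: "\<And>x. rip (T x) x \<le> b * (norm x)\<^sup>2"
  shows "real_spectrum T \<subseteq> {a..b}"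
proof
  fix r assume "r \<in> real_spectrum T"
  then have ninv: "\<not> invertible_op (T - r *\<^sub>R id_blinfun)"
    by (simp add: real_spectrum_iff)
  have lin: "T - r *\<^sub>R id_blinfun \<in> bounded_ops"
    using T by (metis self_adjoint_def self_adjoint_diff self_adjoint_scaleR self_adjoint_id)
  have *: "rip ((T - r *\<^sub>R id_blinfun) x) x = rip (T x) x - r * (norm x)\<^sup>2" for x
    by (simp add: blinfun.bilinear_simps rip.diff_left rip.scaleR_left rip_self)
  have "\<not> r < a"
    using coercive_invertible[OF lin, of "a - r"] lo ninv * by (auto simp: algebra_simps)
  moreover have "\<not> b < r"
  proof
    assume "b < r"
    have "invertible_op ((-1) *\<^sub>R (T - r *\<^sub>R id_blinfun))"
    proof (rule coercive_invertible)
      show "(-1) *\<^sub>R (T - r *\<^sub>R id_blinfun) \<in> bounded_ops"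
        by (rule bounded_ops_scaleR[OF lin])
      show "r - b > 0" using \<open>b < r\<close> by simp
      show "(r - b) * (norm x)\<^sup>2 \<le> rip (((-1) *\<^sub>R (T - r *\<^sub>R id_blinfun)) x) x" for x
        using hi[of x] by (simp only: blinfun.scaleR_left rip.scaleR_left *) (simp add: algebra_simps)
    qed
    from invertible_op_scaleR[OF _ this, of "-1"] ninv show False by simp
  qed
  ultimately show "r \<in> {a..b}" by auto
qed

section \<open>Polynomials of an operator\<close>

lemma op_power_Suc: "((o\<^sub>L) T ^^ Suc i) id_blinfun = T o\<^sub>L ((o\<^sub>L) T ^^ i) id_blinfun"
  by simp

text \<open>
  With the upper summation index decoupled from the degree, sums for different polynomials can be
  compared; the algebra homomorphism properties then follow by induction on \<open>pCons\<close>.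
\<close>

lemma poly_op_eq_sum:
  assumes "degree p \<le> n"
  shows "poly_op p T = (\<Sum>i\<le>n. coeff p i *\<^sub>R (((o\<^sub>L) T ^^ i) id_blinfun))"
  unfolding poly_op_def
  using assms by (intro sum.mono_neutral_left) (auto simp: coeff_eq_0)

lemma poly_op_0 [simp]: "poly_op 0 T = 0"
  by (simp add: poly_op_def)

lemma poly_op_pCons: "poly_op (pCons a p) T = a *\<^sub>R id_blinfun + (T o\<^sub>L poly_op p T)"
proof -
  have "poly_op (pCons a p) T =
      (\<Sum>i\<le>Suc (degree p). coeff (pCons a p) i *\<^sub>R (((o\<^sub>L) T ^^ i) id_blinfun))"
    by (rule poly_op_eq_sum) (rule degree_pCons_le)
  also have "\<dots> = a *\<^sub>R id_blinfun
      + (\<Sum>i\<le>degree p. coeff p i *\<^sub>R (T o\<^sub>L ((o\<^sub>L) T ^^ i) id_blinfun))"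
    by (simp only: sum.atMost_Suc_shift op_power_Suc coeff_pCons_0 coeff_pCons_Suc) simp
  also have "\<dots> = a *\<^sub>R id_blinfun + (T o\<^sub>L poly_op p T)"
    by (simp add: poly_op_def comp.sum_right comp.scaleR_right)
  finally show ?thesis .
qed

lemma poly_op_add: "poly_op (p + q) T = poly_op p T + poly_op q T"
  by (induction p q rule: poly_induct2)
    (simp_all add: poly_op_pCons comp.add_right scaleR_add_left)

lemma poly_op_smult: "poly_op (smult a p) T = a *\<^sub>R poly_op p T"
  by (induction p) (simp_all add: poly_op_pCons comp.scaleR_right scaleR_add_right)

lemma poly_op_diff: "poly_op (p - q) T = poly_op p T - poly_op q T"
  using poly_op_add[of p "- q" T] poly_op_smult[of "-1" q T] by simp

lemma poly_op_mult: "poly_op (p * q) T = poly_op p T o\<^sub>L poly_op q T"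
  by (induction p)
    (simp_all add: mult_pCons_left poly_op_add poly_op_smult poly_op_pCons comp.add_left
      comp.scaleR_left blinfun_compose_assoc)

lemma poly_op_const: "poly_op [:a:] T = a *\<^sub>R id_blinfun"
  by (simp add: poly_op_pCons)

lemma poly_op_linear: "poly_op [:a, b:] T = a *\<^sub>R id_blinfun + b *\<^sub>R T"
  by (simp add: poly_op_pCons comp.scaleR_right)

lemma self_adjoint_poly_op: "self_adjoint T \<Longrightarrow> self_adjoint (poly_op p T)"
proof (induction p)
  case 0
  show ?case using self_adjoint_scaleR[OF self_adjoint_id, of 0] by simp
next
  case (pCons a p)
  have "T o\<^sub>L poly_op p T = poly_op p T o\<^sub>L T"
    using poly_op_mult[of "[:0, 1:]" p T] poly_op_mult[of p "[:0, 1:]" T]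
    by (simp only: poly_op_linear mult.commute[of p]) simp
  with pCons show ?case
    by (simp add: poly_op_pCons self_adjoint_add self_adjoint_scaleR self_adjoint_id self_adjoint_compose)
qed

section \<open>Spectral mapping\<close>

lemma poly_of_real_add:
  fixes p q :: "real poly" and z :: complex
  shows "poly (map_poly of_real (p + q)) z = poly (map_poly of_real p) z + poly (map_poly of_real q) z"
  by (induction p q rule: poly_induct2) (simp_all add: map_poly_pCons algebra_simps)

lemma poly_of_real_mult:
  fixes p q :: "real poly" and z :: complex
  shows "poly (map_poly of_real (p * q)) z = poly (map_poly of_real p) z * poly (map_poly of_real q) z"
proof -
  have smult: "poly (map_poly of_real (smult a q)) z = of_real a * poly (map_poly of_real q) z" for a
    by (induction q) (simp_all add: map_poly_pCons algebra_simps)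
  show ?thesis
    by (induction p) (simp_all add: mult_pCons_left poly_of_real_add smult map_poly_pCons algebra_simps)
qed

text \<open>
  A complex root \<open>z\<close> gives the factor \<open>X - z\<close> if it is real and \<open>(X - z) (X - z\<^sup>*)\<close> if it is not. The
  remainder of \<open>q\<close> modulo this factor also vanishes at \<open>z\<close>; having real coefficients and
  a smaller degree than the factor, it is zero.
\<close>

lemma real_poly_irreducible_factor:
  fixes q :: "real poly"
  assumes "degree q > 0"
  shows "\<exists>d. d dvd q \<and> ((\<exists>r. d = [:- r, 1:]) \<or> (\<exists>a b. b \<noteq> 0 \<and> d = [:a\<^sup>2 + b\<^sup>2, - 2 * a, 1:]))"
proof -
  let ?ev = "\<lambda>p z. poly (map_poly complex_of_real p) z"
  have "degree (map_poly complex_of_real q) > 0"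
    using assms by (simp add: degree_map_poly)
  then obtain z where z: "?ev q z = 0"
    using fundamental_theorem_of_algebra constant_degree by (metis neq0_conv)
  define d where "d = (if Im z = 0 then [:- Re z, 1:]
    else [:(Re z)\<^sup>2 + (Im z)\<^sup>2, - 2 * Re z, 1:])"
  have dz: "?ev d z = 0"
    by (auto simp: d_def map_poly_pCons complex_eq_iff power2_eq_square)
  have "?ev (q mod d) z = 0"
  proof -
    have "?ev (d * (q div d) + q mod d) z = 0"
      using z by simp
    then show ?thesis
      by (simp only: poly_of_real_add poly_of_real_mult dz) simp
  qed
  moreover have "degree (q mod d) < degree d \<or> q mod d = 0"
    by (metis degree_mod_less d_def pCons_eq_0_iff zero_neq_one)
  moreover have "degree d \<le> 2" "Im z = 0 \<Longrightarrow> degree d \<le> 1"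
    by (auto simp: d_def)
  ultimately have "q mod d = 0"
  proof -
    assume ev: "?ev (q mod d) z = 0" and deg: "degree (q mod d) < degree d \<or> q mod d = 0"
      and d2: "degree d \<le> 2" and d1: "Im z = 0 \<Longrightarrow> degree d \<le> 1"
    have "degree (q mod d) \<le> 1" using deg d2 by auto
    then obtain u v where uv: "q mod d = [:u, v:]"
      by (metis One_nat_def degree_pCons_eq_if le_zero_eq not_less_eq_eq pCons_cases degree_eq_zeroE
          pCons_0_0)
    then have "u + v * Re z = 0" "v * Im z = 0"
      using ev by (auto simp: map_poly_pCons complex_eq_iff algebra_simps)
    moreover have "v = 0" if "Im z = 0"
      using deg d1[OF that] uv by (auto split: if_splits)
    ultimately show "q mod d = 0"
      using uv by (cases "v = 0") auto
  qed
  then have "d dvd q" by (simp add: dvd_eq_mod_eq_0)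
  then show ?thesis
    by (intro exI[of _ d]) (auto simp: d_def)
qed

text \<open>
  The half of the spectral mapping theorem that the norm estimate needs. Split off irreducible real
  factors: a linear factor \<open>X - r\<close> has \<open>r\<close> outside the spectrum by assumption, and a quadratic factor
  \<open>(X - a)\<^sup>2 + b\<^sup>2\<close> becomes a coercive operator, whatever the spectrum is.
\<close>

lemma poly_op_invertible:
  assumes T: "self_adjoint T"
  shows "q \<noteq> 0 \<Longrightarrow> (\<And>x. x \<in> real_spectrum T \<Longrightarrow> poly q x \<noteq> 0) \<Longrightarrow> invertible_op (poly_op q T)"
proof (induction "degree q" arbitrary: q rule: less_induct)
  case less
  show ?case
  proof (cases "degree q = 0")
    case True
    then obtain a where "q = [:a:]" "a \<noteq> 0"
      using less.prems(1) by (metis degree_eq_zeroE pCons_0_0)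
    then show ?thesis
      using is_op_inverse_scaleR_id by (auto simp: poly_op_const invertible_op_def)
  next
    case False
    then obtain d where "d dvd q" and d:
      "(\<exists>r. d = [:- r, 1:]) \<or> (\<exists>a b. b \<noteq> 0 \<and> d = [:a\<^sup>2 + b\<^sup>2, - 2 * a, 1:])"
      using real_poly_irreducible_factor by blast
    then obtain k where q: "q = d * k" by blast
    with less.prems have nz: "d \<noteq> 0" "k \<noteq> 0" by auto
    have "degree d > 0" using d by auto
    then have "invertible_op (poly_op k T)"
      using less.prems nz by (intro less.hyps) (auto simp: q degree_mult_eq)
    moreover have "invertible_op (poly_op d T)"
      using d
    proof (elim disjE exE conjE)
      fix r assume r: "d = [:- r, 1:]"
      then have "poly q r = 0" by (simp add: q)
      then have "r \<notin> real_spectrum T" using less.prems by blast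
      then show ?thesis
        by (simp add: r real_spectrum_iff poly_op_linear)
    next
      fix a b :: real
      assume "b \<noteq> 0" and dab: "d = [:a\<^sup>2 + b\<^sup>2, - 2 * a, 1:]"
      let ?l = "[:- a, 1:]"
      have "d = ?l * ?l + [:b\<^sup>2:]"
        by (simp add: dab power2_eq_square)
      then have P: "poly_op d T = (poly_op ?l T o\<^sub>L poly_op ?l T) + b\<^sup>2 *\<^sub>R id_blinfun"
        by (simp only: poly_op_add poly_op_mult poly_op_const)
      show ?thesis
      proof (rule coercive_invertible)
        show "poly_op d T \<in> bounded_ops"
          using self_adjoint_poly_op[OF T] by (simp add: self_adjoint_def)
        show "0 < b\<^sup>2" using \<open>b \<noteq> 0\<close> by simp
        show "b\<^sup>2 * (norm x)\<^sup>2 \<le> rip (poly_op d T x) x" for x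
          using self_adjointD[OF self_adjoint_poly_op[OF T, of ?l], of "poly_op ?l T x" x]
          by (simp add: P blinfun.bilinear_simps rip.add_left rip.scaleR_left rip_self)
      qed
    qed
    ultimately show ?thesis
      by (simp add: q poly_op_mult invertible_op_compose)
  qed
qed

section \<open>The norm of a self-adjoint operator\<close>

text \<open>
  Read contrapositively: on a nonzero space \<open>\<parallel>S\<parallel>\<^sup>2\<close> belongs to the spectrum of \<open>S\<^sup>2\<close>. Vectors that almost
  attain the norm are approximate eigenvectors, since
  \<open>\<parallel>S\<^sup>2 x - N\<^sup>2 x\<parallel>\<^sup>2 = \<parallel>S\<^sup>2 x\<parallel>\<^sup>2 - 2 N\<^sup>2 \<parallel>S x\<parallel>\<^sup>2 + N\<^sup>4 \<parallel>x\<parallel>\<^sup>2\<close> with \<open>N = \<parallel>S\<parallel>\<close>. A lower bound \<open>k \<parallel>x\<parallel>\<close> for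
  \<open>\<parallel>S\<^sup>2 x - N\<^sup>2 x\<parallel>\<close> would therefore force \<open>\<parallel>S x\<parallel>\<^sup>2 \<le> (N\<^sup>2 - k\<^sup>2 / (2 N\<^sup>2)) \<parallel>x\<parallel>\<^sup>2\<close>, a better bound than the norm.
\<close>

lemma norm_square_in_spectrum:
  fixes S :: "'a::chilbert_space \<Rightarrow>\<^sub>L 'a"
  assumes S: "self_adjoint S" and inv: "invertible_op ((S o\<^sub>L S) - (norm S)\<^sup>2 *\<^sub>R id_blinfun)"
  shows "norm S = 0 \<and> (\<forall>x :: 'a. x = 0)"
proof -
  define N where "N = norm S"
  obtain k where k: "k > 0" "\<And>x. k * norm x \<le> norm (S (S x) - N\<^sup>2 *\<^sub>R x)"
    using invertible_op_bounded_below[OF inv] by (auto simp: N_def blinfun.bilinear_simps)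
  have key: "2 * N\<^sup>2 * (norm (S x))\<^sup>2 \<le> (2 * N ^ 4 - k\<^sup>2) * (norm x)\<^sup>2" for x
  proof -
    have "norm (S (S x)) \<le> N * norm (S x)"
      by (simp add: N_def norm_blinfun)
    also have "\<dots> \<le> N * (N * norm x)"
      by (intro mult_left_mono) (auto simp: N_def norm_blinfun)
    finally have "(norm (S (S x)))\<^sup>2 \<le> (N * (N * norm x))\<^sup>2"
      by (simp add: power_mono)
    then have 1: "(norm (S (S x)))\<^sup>2 \<le> N ^ 4 * (norm x)\<^sup>2"
      by (simp add: power_mult_distrib mult.assoc[symmetric] flip: power_add)
    have "k\<^sup>2 * (norm x)\<^sup>2 \<le> (norm (S (S x) - N\<^sup>2 *\<^sub>R x))\<^sup>2"
      using k by (simp flip: power_mult_distrib add: power_mono)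
    also have "\<dots> = (norm (S (S x)))\<^sup>2 - 2 * N\<^sup>2 * (norm (S x))\<^sup>2 + N ^ 4 * (norm x)\<^sup>2"
      using self_adjointD[OF S, of "S x" x]
      by (simp add: norm_diff_square rip.scaleR_right rip_self power_mult_distrib flip: power_mult)
    finally show ?thesis using 1 by (simp add: algebra_simps)
  qed
  have "N = 0"
  proof (rule ccontr)
    assume "N \<noteq> 0"
    then have N: "N > 0" by (simp add: N_def)
    \<comment> \<open>The maximum with zero only serves to have a square root.\<close>
    define m where "m = max 0 (N\<^sup>2 - k\<^sup>2 / (2 * N\<^sup>2))"
    have "norm (S x) \<le> sqrt m * norm x" for x
    proof (rule power2_le_imp_le)
      have "(norm (S x))\<^sup>2 \<le> (N\<^sup>2 - k\<^sup>2 / (2 * N\<^sup>2)) * (norm x)\<^sup>2"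
        using key[of x] N by (simp add: field_simps flip: power_add)
      also have "\<dots> \<le> m * (norm x)\<^sup>2"
        by (intro mult_right_mono) (auto simp: m_def)
      finally show "(norm (S x))\<^sup>2 \<le> (sqrt m * norm x)\<^sup>2"
        by (simp add: power_mult_distrib m_def)
    qed (auto simp: m_def)
    then have "N \<le> sqrt m"
      unfolding N_def by (intro norm_blinfun_bound) (auto simp: m_def)
    then have "N\<^sup>2 \<le> m"
      using N by (metis less_imp_le power_mono real_sqrt_pow2 m_def max.cobounded1)
    moreover have "N\<^sup>2 > 0" "k\<^sup>2 / (2 * N\<^sup>2) > 0" using N k by auto
    ultimately show False by (simp add: m_def max_def split: if_splits)
  qed
  moreover have "x = 0" for x :: 'a
    using key[of x] k \<open>N = 0\<close> by (simp add: mult_le_0_iff zero_le_mult_iff)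
  ultimately show ?thesis by (simp add: N_def)
qed

text \<open>
  If \<open>N = \<parallel>p(T)\<parallel>\<close> exceeded \<open>e\<close>, the polynomial \<open>p\<^sup>2 - N\<^sup>2\<close> would have no zero on the real spectrum, so
  \<open>p(T)\<^sup>2 - N\<^sup>2\<close> would be invertible, which is impossible on a nonzero space. If \<open>p\<^sup>2 - N\<^sup>2\<close> is the zero
  polynomial, the absence of zeros means that the real spectrum is empty, and the same argument for
  the polynomial \<open>X\<close> in place of \<open>p\<close> excludes this.
\<close>

lemma norm_poly_op_le:
  fixes T :: "'a::chilbert_space \<Rightarrow>\<^sub>L 'a"
  assumes T: "self_adjoint T" and "0 \<le> e" and e: "\<And>x. x \<in> real_spectrum T \<Longrightarrow> \<bar>poly p x\<bar> \<le> e"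
  shows "norm (poly_op p T) \<le> e"
proof (rule ccontr)
  have inv: "invertible_op ((poly_op p T o\<^sub>L poly_op p T) - (norm (poly_op p T))\<^sup>2 *\<^sub>R id_blinfun)"
    if "p * p - [:(norm (poly_op p T))\<^sup>2:] \<noteq> 0"
      and "\<And>x. x \<in> real_spectrum T \<Longrightarrow> (poly p x)\<^sup>2 \<noteq> (norm (poly_op p T))\<^sup>2" for p
    using poly_op_invertible[OF T that(1)] that(2)
    by (simp add: poly_op_diff poly_op_mult poly_op_const power2_eq_square)
  assume "\<not> norm (poly_op p T) \<le> e"
  then have N: "norm (poly_op p T) > e" by simp
  have ne: "(poly p x)\<^sup>2 \<noteq> (norm (poly_op p T))\<^sup>2" if "x \<in> real_spectrum T" for x
    using e[OF that] N by (auto simp: power2_eq_iff)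
  have nontrivial: "\<not> (\<forall>x :: 'a. x = 0)"
  proof
    assume 0: "\<forall>x :: 'a. x = 0"
    have "poly_op p T = 0"
      by (rule blinfun_eqI) (metis 0)
    with N \<open>0 \<le> e\<close> show False by simp
  qed
  show False
  proof (cases "p * p - [:(norm (poly_op p T))\<^sup>2:] = 0")
    case False
    from norm_square_in_spectrum[OF self_adjoint_poly_op[OF T] inv[OF False ne]] nontrivial
    show False by blast
  next
    case True
    then have "poly (p * p - [:(norm (poly_op p T))\<^sup>2:]) x = 0" for x by simp
    then have "real_spectrum T = {}"
      using ne by (fastforce simp: power2_eq_square)
    moreover have "[:0, 1:] * [:0, 1:] - [:c:] \<noteq> 0" for c :: real
      by simp
    ultimately have "invertible_op ((poly_op [:0, 1:] T o\<^sub>L poly_op [:0, 1:] T)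
        - (norm (poly_op [:0, 1:] T))\<^sup>2 *\<^sub>R id_blinfun)"
      by (intro inv) auto
    from norm_square_in_spectrum[OF self_adjoint_poly_op[OF T] this] nontrivial
    show False by blast
  qed
qed

section \<open>Continuous functional calculus\<close>

lemma uniform_polynomial_approx:
  fixes f :: "real \<Rightarrow> real"
  assumes "continuous_on {a..b} f"
  obtains p :: "nat \<Rightarrow> real poly" where "uniform_limit {a..b} (\<lambda>n. poly (p n)) f sequentially"
proof -
  have "\<exists>p. \<forall>x\<in>{a..b}. \<bar>f x - poly p x\<bar> < 1 / real (Suc n)" for n
  proof -
    obtain g where g: "real_polynomial_function g" "\<And>x. x \<in> {a..b} \<Longrightarrow> \<bar>f x - g x\<bar> < 1 / real (Suc n)"
      using Stone_Weierstrass_real_polynomial_function[OF _ assms, of "1 / real (Suc n)"] by auto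
    then obtain c N where "g = (\<lambda>x. \<Sum>i\<le>N. c i * x ^ i)"
      using real_polynomial_function_iff_sum by auto
    then have "g x = poly (\<Sum>i\<le>N. monom (c i) i) x" for x
      by (simp add: poly_sum poly_monom)
    with g show ?thesis by metis
  qed
  then obtain p where p: "\<And>n x. x \<in> {a..b} \<Longrightarrow> \<bar>f x - poly (p n) x\<bar> < 1 / real (Suc n)"
    by metis
  have "uniform_limit {a..b} (\<lambda>n. poly (p n)) f sequentially"
  proof (rule uniform_limitI)
    fix e :: real assume "e > 0"
    then obtain N where N: "1 / real (Suc N) < e"
      by (metis nat_approx_posE)
    have "dist (poly (p n) x) (f x) < e" if "n \<ge> N" "x \<in> {a..b}" for n x
    proof -
      have "1 / real (Suc n) \<le> 1 / real (Suc N)"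
        using that by (intro divide_left_mono) auto
      then show ?thesis
        using p[OF that(2), of n] N by (simp add: dist_real_def abs_minus_commute)
    qed
    then show "\<forall>\<^sub>F n in sequentially. \<forall>x\<in>{a..b}. dist (poly (p n) x) (f x) < e"
      unfolding eventually_sequentially by blast
  qed
  then show ?thesis by (rule that)
qed

text \<open>
  The limit in the definition of \<open>cfc\<close> is the same for all approximating sequences.
\<close>

lemma poly_op_tendsto_0:
  assumes T: "self_adjoint T"
    and "uniform_limit (real_spectrum T) (\<lambda>n. poly (p n)) f sequentially"
    and "uniform_limit (real_spectrum T) (\<lambda>n. poly (q n)) f sequentially"
  shows "(\<lambda>n. poly_op (p n) T - poly_op (q n) T) \<longlonglongrightarrow> 0"
proof (rule tendstoI)
  fix e :: real assume "e > 0"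
  have "uniform_limit (real_spectrum T) (\<lambda>n x. poly (p n) x - poly (q n) x) (\<lambda>x. f x - f x) sequentially"
    by (intro uniform_limit_minus assms)
  from uniform_limitD[OF this, of "e / 2"] \<open>e > 0\<close>
  have "\<forall>\<^sub>F n in sequentially. \<forall>x\<in>real_spectrum T. \<bar>poly (p n - q n) x\<bar> < e / 2"
    by (simp add: dist_real_def)
  then show "\<forall>\<^sub>F n in sequentially. dist (poly_op (p n) T - poly_op (q n) T) 0 < e"
  proof eventually_elim
    case (elim n)
    then have "norm (poly_op (p n - q n) T) \<le> e / 2"
      using \<open>e > 0\<close> by (intro norm_poly_op_le[OF T]) (auto intro: less_imp_le)
    with \<open>e > 0\<close> show ?case by (simp add: poly_op_diff)
  qed
qed

lemma poly_op_Cauchy: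
  assumes T: "self_adjoint T"
    and lim: "uniform_limit (real_spectrum T) (\<lambda>n. poly (p n)) f sequentially"
  shows "Cauchy (\<lambda>n. poly_op (p n) T)"
proof (rule metric_CauchyI)
  fix e :: real assume "e > 0"
  from uniform_limitD[OF lim, of "e / 4"] \<open>e > 0\<close>
  obtain N where N: "\<And>n x. n \<ge> N \<Longrightarrow> x \<in> real_spectrum T \<Longrightarrow> \<bar>poly (p n) x - f x\<bar> < e / 4"
    by (auto simp: eventually_sequentially dist_real_def)
  have "dist (poly_op (p m) T) (poly_op (p n) T) < e" if "m \<ge> N" "n \<ge> N" for m n
  proof -
    have "norm (poly_op (p m - p n) T) \<le> e / 2"
    proof (rule norm_poly_op_le[OF T])
      fix x assume x: "x \<in> real_spectrum T"
      show "\<bar>poly (p m - p n) x\<bar> \<le> e / 2"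
        using N[OF that(1) x] N[OF that(2) x] unfolding poly_diff by linarith
    qed (use \<open>e > 0\<close> in auto)
    with \<open>e > 0\<close> show ?thesis by (simp add: poly_op_diff dist_norm)
  qed
  then show "\<exists>N. \<forall>m\<ge>N. \<forall>n\<ge>N. dist (poly_op (p m) T) (poly_op (p n) T) < e" by blast
qed

text \<open>
  Approximation on an interval that contains the real spectrum suffices to compute \<open>cfc\<close>, and there
  the Weierstrass theorem provides polynomials.
\<close>

locale spectrum_in_interval =
  fixes T :: "'a::chilbert_space \<Rightarrow>\<^sub>L 'a" and a b :: real
  assumes self_adjoint: "self_adjoint T" and spectrum_subset: "real_spectrum T \<subseteq> {a..b}"
begin

lemma cfc_tendsto:
  assumes f: "continuous_on {a..b} f"
    and lim: "uniform_limit {a..b} (\<lambda>n. poly (p n)) f sequentially"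
  shows "(\<lambda>n. poly_op (p n) T) \<longlonglongrightarrow> cfc f T"
proof -
  note lim' = uniform_limit_on_subset[OF lim spectrum_subset]
  obtain S where S: "(\<lambda>n. poly_op (p n) T) \<longlonglongrightarrow> S"
    using Cauchy_convergent[OF poly_op_Cauchy[OF self_adjoint lim']] by (auto simp: convergent_def)
  have all: "(\<lambda>n. poly_op (q n) T) \<longlonglongrightarrow> S"
    if "uniform_limit (real_spectrum T) (\<lambda>n. poly (q n)) f sequentially" for q
    using tendsto_add[OF poly_op_tendsto_0[OF self_adjoint that lim'] S] by simp
  have "cfc f T = S"
    unfolding cfc_def real_spectrum_def[symmetric]
  proof (rule the_equality)
    show "\<forall>p. uniform_limit (real_spectrum T) (\<lambda>n x. poly (p n) x) f sequentially \<longrightarrow>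
        (\<lambda>n. poly_op (p n) T) \<longlonglongrightarrow> S"
      using all by blast
    show "R = S" if "\<forall>p. uniform_limit (real_spectrum T) (\<lambda>n x. poly (p n) x) f sequentially \<longrightarrow>
        (\<lambda>n. poly_op (p n) T) \<longlonglongrightarrow> R" for R
      using that lim' S LIMSEQ_unique by blast
  qed
  with S show ?thesis by simp
qed

lemma cfc_eqI:
  assumes "continuous_on {a..b} f"
    and "uniform_limit {a..b} (\<lambda>n. poly (p n)) f sequentially" and "(\<lambda>n. poly_op (p n) T) \<longlonglongrightarrow> S"
  shows "cfc f T = S"
  using cfc_tendsto[OF assms(1,2)] assms(3) LIMSEQ_unique by blast

lemma cfc_linear: "cfc (\<lambda>x. u + v * x) T = u *\<^sub>R id_blinfun + v *\<^sub>R T"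
  by (rule cfc_eqI[where p = "\<lambda>n. [:u, v:]"])
    (auto intro!: continuous_intros uniform_limitI simp: poly_op_linear algebra_simps)

lemma cfc_cong:
  assumes "\<And>x. x \<in> {a..b} \<Longrightarrow> f x = g x"
  shows "cfc f T = cfc g T"
proof -
  have "uniform_limit (real_spectrum T) p f sequentially = uniform_limit (real_spectrum T) p g sequentially"
    for p :: "nat \<Rightarrow> real \<Rightarrow> real"
    using assms spectrum_subset by (intro uniform_limit_cong') auto
  then show ?thesis
    unfolding cfc_def real_spectrum_def[symmetric] by simp
qed

lemma cfc_add:
  assumes "continuous_on {a..b} f" "continuous_on {a..b} g"
  shows "cfc (\<lambda>x. f x + g x) T = cfc f T + cfc g T"
proof -
  obtain p q where lim: "uniform_limit {a..b} (\<lambda>n. poly (p n)) f sequentially"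
      "uniform_limit {a..b} (\<lambda>n. poly (q n)) g sequentially"
    using assms uniform_polynomial_approx by metis
  show ?thesis
  proof (rule cfc_eqI[where p = "\<lambda>n. p n + q n"])
    show "uniform_limit {a..b} (\<lambda>n. poly (p n + q n)) (\<lambda>x. f x + g x) sequentially"
      using uniform_limit_add[OF lim] by (simp flip: poly_add)
    show "(\<lambda>n. poly_op (p n + q n) T) \<longlonglongrightarrow> cfc f T + cfc g T"
      unfolding poly_op_add by (intro tendsto_add cfc_tendsto assms lim)
  qed (intro continuous_intros assms)
qed

lemma cfc_diff:
  assumes f: "continuous_on {a..b} f" and g: "continuous_on {a..b} g"
  shows "cfc (\<lambda>x. f x - g x) T = cfc f T - cfc g T"
  using cfc_add[OF continuous_on_diff[OF f g] g] by simp

lemma cfc_mult: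
  assumes "continuous_on {a..b} f" "continuous_on {a..b} g"
  shows "cfc (\<lambda>x. f x * g x) T = cfc f T o\<^sub>L cfc g T"
proof -
  obtain p q where lim: "uniform_limit {a..b} (\<lambda>n. poly (p n)) f sequentially"
      "uniform_limit {a..b} (\<lambda>n. poly (q n)) g sequentially"
    using assms uniform_polynomial_approx by metis
  have bdd: "bounded (f ` {a..b})" "bounded (g ` {a..b})"
    using assms by (simp_all add: compact_continuous_image compact_imp_bounded)
  show ?thesis
  proof (rule cfc_eqI[where p = "\<lambda>n. p n * q n"])
    show "uniform_limit {a..b} (\<lambda>n. poly (p n * q n)) (\<lambda>x. f x * g x) sequentially"
      using uniform_lim_mult[OF lim bdd] by (simp flip: poly_mult)
    show "(\<lambda>n. poly_op (p n * q n) T) \<longlonglongrightarrow> (cfc f T o\<^sub>L cfc g T)"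
      unfolding poly_op_mult by (intro comp.tendsto cfc_tendsto assms lim)
  qed (intro continuous_intros assms)
qed

lemma cfc_const: "cfc (\<lambda>x. c) T = c *\<^sub>R id_blinfun"
  using cfc_linear[of c 0] by simp

lemma cfc_ident: "cfc (\<lambda>x. x) T = T"
  using cfc_linear[of 0 1] by simp

lemma cfc_cmult:
  assumes "continuous_on {a..b} f"
  shows "cfc (\<lambda>x. c * f x) T = c *\<^sub>R cfc f T"
  using cfc_mult[of "\<lambda>x. c" f] assms by (simp add: cfc_const comp.scaleR_left)

lemma self_adjoint_cfc:
  assumes "continuous_on {a..b} f"
  shows "self_adjoint (cfc f T)"
proof -
  obtain p where "uniform_limit {a..b} (\<lambda>n. poly (p n)) f sequentially"
    using assms uniform_polynomial_approx by metis
  from self_adjoint_tendsto[OF self_adjoint_poly_op[OF self_adjoint] cfc_tendsto[OF assms this]]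
  show ?thesis .
qed

text \<open>
  The nonnegative function \<open>g - f\<close> is the square of a continuous real function, so \<open>(g - f)(T)\<close> is the
  square of a self-adjoint operator.
\<close>

lemma cfc_mono:
  assumes f: "continuous_on {a..b} f" and g: "continuous_on {a..b} g"
    and le: "\<And>x. x \<in> {a..b} \<Longrightarrow> f x \<le> g x"
  shows "cfc f T \<le>\<^sub>o\<^sub>p cfc g T"
proof (rule op_leI)
  fix x
  let ?h = "\<lambda>x. sqrt (g x - f x)"
  have h: "continuous_on {a..b} ?h"
    by (intro continuous_intros f g)
  have "cfc g T - cfc f T = cfc (\<lambda>x. g x - f x) T"
    by (simp add: cfc_diff f g)
  also have "\<dots> = cfc (\<lambda>x. ?h x * ?h x) T"
    by (rule cfc_cong) (simp add: le)
  also have "\<dots> = cfc ?h T o\<^sub>L cfc ?h T"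
    by (rule cfc_mult[OF h h])
  finally have "rip ((cfc g T - cfc f T) x) x = rip (cfc ?h T x) (cfc ?h T x)"
    using self_adjointD[OF self_adjoint_cfc[OF h]] by simp
  then have "0 \<le> rip ((cfc g T - cfc f T) x) x"
    by (simp only: rip_self zero_le_power2)
  then show "rip (cfc f T x) x \<le> rip (cfc g T x) x"
    by (simp add: blinfun.bilinear_simps rip.diff_left)
qed (intro self_adjoint_cfc f g)+

lemma is_op_inverse_cfc:
  assumes f: "continuous_on {a..b} f" and nz: "\<And>x. x \<in> {a..b} \<Longrightarrow> f x \<noteq> 0"
  shows "is_op_inverse (cfc f T) (cfc (\<lambda>x. inverse (f x)) T)"
proof -
  have g: "continuous_on {a..b} (\<lambda>x. inverse (f x))"
    by (intro continuous_intros f) (auto simp: nz)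
  have "cfc f T o\<^sub>L cfc (\<lambda>x. inverse (f x)) T = cfc (\<lambda>x. 1) T"
    unfolding cfc_mult[OF f g, symmetric] by (rule cfc_cong) (simp add: nz)
  moreover have "cfc (\<lambda>x. inverse (f x)) T o\<^sub>L cfc f T = cfc (\<lambda>x. 1) T"
    unfolding cfc_mult[OF g f, symmetric] by (rule cfc_cong) (simp add: nz)
  ultimately show ?thesis
    using self_adjoint_cfc[OF g] by (simp add: is_op_inverse_def cfc_const self_adjoint_def)
qed

lemma continuous_on_powr_interval: "0 < a \<Longrightarrow> continuous_on {a..b} (\<lambda>x. x powr r)"
  by (intro continuous_intros) auto

lemma self_adjoint_op_powr: "0 < a \<Longrightarrow> self_adjoint (T powr\<^sub>o\<^sub>p r)"
  unfolding op_powr_def by (intro self_adjoint_cfc continuous_on_powr_interval)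

lemma op_powr_add: "0 < a \<Longrightarrow> T powr\<^sub>o\<^sub>p r o\<^sub>L T powr\<^sub>o\<^sub>p q = T powr\<^sub>o\<^sub>p (r + q)"
  unfolding op_powr_def
  by (simp add: cfc_mult[symmetric] continuous_on_powr_interval powr_add)

lemma op_powr_1: "0 < a \<Longrightarrow> T powr\<^sub>o\<^sub>p 1 = T"
  unfolding op_powr_def by (subst (2) cfc_ident[symmetric]) (rule cfc_cong, simp)

lemma op_powr_0: "0 < a \<Longrightarrow> T powr\<^sub>o\<^sub>p 0 = id_blinfun"
  using cfc_cong[of "\<lambda>x. x powr 0" "\<lambda>x. 1"] by (simp add: op_powr_def cfc_const)

end

section \<open>Weighted means\<close>

text \<open>
  A convex function on an interval is largest at an endpoint.
\<close>

lemma exp_combination_le_endpoints: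
  fixes l u :: real
  assumes w: "0 \<le> \<alpha>" "\<alpha> \<le> 1" and y: "y \<in> {l..u}"
  shows "(1 - \<alpha>) * exp (p * y) + \<alpha> * exp (q * y)
    \<le> max ((1 - \<alpha>) * exp (p * u) + \<alpha> * exp (q * u)) ((1 - \<alpha>) * exp (p * l) + \<alpha> * exp (q * l))"
proof -
  define h where "h y = (1 - \<alpha>) * exp (p * y) + \<alpha> * exp (q * y)" for y
  have "convex_on UNIV (\<lambda>y. exp (c * y))" for c :: real
    by (rule f''_ge0_imp_convex[where f' = "\<lambda>y. c * exp (c * y)" and f'' = "\<lambda>y. c * (c * exp (c * y))"])
      (auto intro!: derivative_eq_intros simp: mult.assoc[symmetric])
  then have h: "convex_on UNIV h"
    unfolding h_def using w by (intro convex_on_add convex_on_cmul) auto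
  from y have "y \<in> closed_segment l u"
    by (auto simp: closed_segment_eq_real_ivl)
  then obtain v where v: "0 \<le> v" "v \<le> 1" "y = (1 - v) * l + v * u"
    by (auto simp: closed_segment_def)
  have "h y \<le> (1 - v) * h l + v * h u"
    using convex_onD[OF h, of v l u] v by simp
  also have "\<dots> \<le> (1 - v) * max (h u) (h l) + v * max (h u) (h l)"
    using v by (intro add_mono mult_left_mono) auto
  also have "\<dots> = max (h u) (h l)"
    by (simp add: algebra_simps)
  finally show ?thesis by (simp add: h_def)
qed

text \<open>
  In the variable \<open>y = ln x\<close> the mean is a convex combination of exponentials. It need not be convex
  in \<open>x\<close> itself.
\<close>

lemma powr_mean_le_endpoints:
  fixes s t x :: real
  assumes "\<alpha> \<in> {0..1}" "0 < s" "x \<in> {s..t}"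
  shows "x powr p \<nabla>\<^bsub>\<alpha>\<^esub> x powr q \<le> max (t powr p \<nabla>\<^bsub>\<alpha>\<^esub> t powr q) (s powr p \<nabla>\<^bsub>\<alpha>\<^esub> s powr q)"
  using exp_combination_le_endpoints[of \<alpha> "ln x" "ln s" "ln t" p q] assms
  by (simp add: arith_mean_def powr_def)

lemma powr_mean_pos:
  fixes x :: real
  assumes "\<alpha> \<in> {0..1}" "0 < x"
  shows "0 < x powr p \<nabla>\<^bsub>\<alpha>\<^esub> x powr q"
  using assms by (cases "\<alpha> = 0") (auto simp: arith_mean_def intro!: add_nonneg_pos)

lemma op_le_sandwich:
  assumes S: "self_adjoint S" and "T \<le>\<^sub>o\<^sub>p U" "self_adjoint T" "self_adjoint U"
  shows "S o\<^sub>L T o\<^sub>L S \<le>\<^sub>o\<^sub>p S o\<^sub>L U o\<^sub>L S"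
  using assms by (intro op_leI self_adjoint_sandwich) (simp_all add: self_adjointD[OF S] op_leD)

text \<open>
  The spectrum of \<open>A\<close> lies in an interval \<open>[c, \<parallel>A\<parallel>]\<close> with \<open>c > 0\<close>, on which all powers are continuous, so
  the exponent laws hold for the operator powers.
\<close>

lemma strictly_positive_op_sqrt:
  assumes A: "strictly_positive_op A"
  defines "X \<equiv> A powr\<^sub>o\<^sub>p (1/2)" and "Y \<equiv> A powr\<^sub>o\<^sub>p (-1/2)"
  shows "self_adjoint X" "self_adjoint Y" "is_op_inverse X Y" "X o\<^sub>L X = A"
proof -
  obtain c where c: "c > 0" "\<And>x. c * (norm x)\<^sup>2 \<le> rip (A x) x"
    using strictly_positive_coercive[OF A] by blast
  have sa: "self_adjoint A"
    using A by (simp add: strictly_positive_op_def positive_op_iff)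
  have "rip (A x) x \<le> norm A * (norm x)\<^sup>2" for x
  proof -
    have "rip (A x) x \<le> (norm A * norm x) * norm x"
      by (rule order_trans[OF rip_le_norm]) (intro mult_right_mono norm_blinfun norm_ge_zero)
    then show ?thesis by (simp add: power2_eq_square)
  qed
  with c sa interpret spectrum_in_interval A c "norm A"
    by unfold_locales (auto dest: real_spectrum_subset)
  show X: "self_adjoint X" and Y: "self_adjoint Y"
    unfolding X_def Y_def by (intro self_adjoint_op_powr c)+
  show "X o\<^sub>L X = A"
    unfolding X_def by (simp add: op_powr_add op_powr_1 c)
  have "X o\<^sub>L Y = id_blinfun" "Y o\<^sub>L X = id_blinfun"
    unfolding X_def Y_def by (simp_all add: op_powr_add op_powr_0 c)
  with Y show "is_op_inverse X Y"
    by (simp add: is_op_inverse_def self_adjoint_def)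
qed

text \<open>
  The harmonic mean is compatible with congruences \<open>Z \<mapsto> X Z X\<close>: in the notation below
  \<open>(1 - \<alpha>) A\<^sup>-\<^sup>1 + \<alpha> B\<^sup>-\<^sup>1 = Y ((1 - \<alpha>) + \<alpha> T') Y\<close> for \<open>A = X X\<close> and \<open>B = X T X\<close>.
\<close>

lemma harm_mean_congruence:
  assumes lin: "X \<in> bounded_ops" and X: "is_op_inverse X Y" and T: "is_op_inverse T T'"
    and R: "is_op_inverse ((1 - \<alpha>) *\<^sub>R id_blinfun + \<alpha> *\<^sub>R T') R"
  shows "(X o\<^sub>L X) !\<^bsub>\<alpha>\<^esub> (X o\<^sub>L T o\<^sub>L X) = X o\<^sub>L R o\<^sub>L X"
proof -
  have Y: "is_op_inverse Y X"
    using X lin by (simp add: is_op_inverse_def)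
  have "op_inverse (X o\<^sub>L X) = Y o\<^sub>L Y"
    by (intro op_inverse_eqI is_op_inverse_compose X)
  moreover have "op_inverse (X o\<^sub>L T o\<^sub>L X) = Y o\<^sub>L (T' o\<^sub>L Y)"
    by (intro op_inverse_eqI is_op_inverse_compose X T)
  ultimately have "(X o\<^sub>L X) !\<^bsub>\<alpha>\<^esub> (X o\<^sub>L T o\<^sub>L X) =
      op_inverse (Y o\<^sub>L ((1 - \<alpha>) *\<^sub>R id_blinfun + \<alpha> *\<^sub>R T') o\<^sub>L Y)"
    by (simp add: harm_mean_def comp.add_left comp.add_right comp.scaleR_left comp.scaleR_right
        blinfun_compose_assoc)
  also have "\<dots> = X o\<^sub>L (R o\<^sub>L X)"
    by (intro op_inverse_eqI is_op_inverse_compose Y R)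
  finally show ?thesis
    by (simp only: blinfun_compose_assoc)
qed

theorem theorem2p1:
  fixes A B :: "'a::chilbert_space \<Rightarrow>\<^sub>L 'a" and \<alpha> \<beta> s t lam \<mu> :: real
  assumes "positive_op A" and "positive_op B"
    and "\<alpha> \<in> {0..1}" and "\<beta> \<in> {0..1}"
    and "0 < s" and "s \<le> t"
    and "strictly_positive_op (s *\<^sub>R A)" and "s *\<^sub>R A \<le>\<^sub>o\<^sub>p B" and "B \<le>\<^sub>o\<^sub>p t *\<^sub>R A"
    and "lam = max (t powr (-\<beta>) \<nabla>\<^bsub>\<alpha>\<^esub> t powr (1 - \<beta>)) (s powr (-\<beta>) \<nabla>\<^bsub>\<alpha>\<^esub> s powr (1 - \<beta>))"
    and "\<mu> = max (t powr \<beta> \<nabla>\<^bsub>\<alpha>\<^esub> t powr (-(1 - \<beta>))) (s powr \<beta> \<nabla>\<^bsub>\<alpha>\<^esub> s powr (-(1 - \<beta>)))"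
  shows "inverse lam *\<^sub>R (A \<nabla>\<^bsub>\<alpha>\<^esub> B) \<le>\<^sub>o\<^sub>p A \<sharp>\<^bsub>\<beta>\<^esub> B
    \<and> A \<sharp>\<^bsub>\<beta>\<^esub> B \<le>\<^sub>o\<^sub>p \<mu> *\<^sub>R (A !\<^bsub>\<alpha>\<^esub> B)"
proof -
  have "invertible_op A"
    using invertible_op_scaleR[of "inverse s" "s *\<^sub>R A"] assms(5,7)
    by (simp add: strictly_positive_op_def)
  with assms(1) have A: "strictly_positive_op A"
    by (simp add: strictly_positive_op_def)
  define X where "X = A powr\<^sub>o\<^sub>p (1/2)"
  define Y where "Y = A powr\<^sub>o\<^sub>p (-1/2)"
  note root = strictly_positive_op_sqrt[OF A, folded X_def Y_def]
  \<comment> \<open>Reduction to \<open>A = 1\<close>: the congruence by \<open>X = A\<^sup>1\<^sup>/\<^sup>2\<close> turns \<open>1, T\<close> into \<open>A, B\<close>, and \<open>s \<le> T \<le> t\<close>.\<close>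
  have inv: "X (Y x) = x" "Y (X x) = x" and sq: "A x = X (X x)" for x
    using root(3) by (auto simp: is_op_inverse_def root(4)[symmetric]
        simp flip: blinfun_apply_blinfun_compose)
  define T where "T = Y o\<^sub>L B o\<^sub>L Y"
  have B_eq: "B = X o\<^sub>L T o\<^sub>L X"
    by (rule blinfun_eqI) (simp add: T_def inv)
  have sa_T: "self_adjoint T"
    unfolding T_def using assms(2) by (intro self_adjoint_sandwich root) (simp add: positive_op_iff)
  have form_T: "rip (T x) x = rip (B (Y x)) (Y x)" and form_A: "rip (A (Y x)) (Y x) = (norm x)\<^sup>2" for x
    using self_adjointD[OF root(2), of "B (Y x)" x] self_adjointD[OF root(1), of x "Y x"]
    by (simp_all add: T_def sq inv rip_self)
  have "s * (norm x)\<^sup>2 \<le> rip (T x) x" "rip (T x) x \<le> t * (norm x)\<^sup>2" for x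
    using op_leD[OF assms(8), of "Y x"] op_leD[OF assms(9), of "Y x"]
    by (simp_all add: form_T blinfun.scaleR_left rip.scaleR_left form_A)
  with sa_T interpret spectrum_in_interval T s t
    by unfold_locales (auto dest: real_spectrum_subset)
  have geo: "A \<sharp>\<^bsub>\<beta>\<^esub> B = X o\<^sub>L cfc (\<lambda>x. x powr \<beta>) T o\<^sub>L X"
    by (simp add: geo_mean_def X_def Y_def T_def op_powr_def)
  have c\<beta>: "continuous_on {s..t} (\<lambda>x. x powr \<beta>)"
    by (rule continuous_on_powr_interval[OF assms(5)])
  have "lam > 0"
    using powr_mean_pos[OF assms(3,5)] by (auto simp: assms(10) less_max_iff_disj)

  have "inverse lam *\<^sub>R (A \<nabla>\<^bsub>\<alpha>\<^esub> B) \<le>\<^sub>o\<^sub>p A \<sharp>\<^bsub>\<beta>\<^esub> B"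
  proof -
    \<comment> \<open>Scalar inequality \<open>(1 - \<alpha>) + \<alpha> x \<le> lam x\<^sup>\<beta>\<close>, which is the mean of \<open>x\<^sup>-\<^sup>\<beta>\<close> and \<open>x\<^sup>1\<^sup>-\<^sup>\<beta>\<close> being at most \<open>lam\<close>.\<close>
    let ?f = "\<lambda>x. inverse lam * (1 - \<alpha>) + inverse lam * \<alpha> * x"
    have f: "continuous_on {s..t} ?f" by (intro continuous_intros)
    have "?f x \<le> x powr \<beta>" if "x \<in> {s..t}" for x
    proof -
      have x: "x > 0" using that assms(5) by simp
      have "x powr (-\<beta>) \<nabla>\<^bsub>\<alpha>\<^esub> x powr (1 - \<beta>) \<le> lam"
        unfolding assms(10) by (rule powr_mean_le_endpoints[OF assms(3,5) that])
      then have "x powr \<beta> * (x powr (-\<beta>) \<nabla>\<^bsub>\<alpha>\<^esub> x powr (1 - \<beta>)) \<le> x powr \<beta> * lam"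
        by (simp add: mult_left_mono)
      then have "(1 - \<alpha>) + \<alpha> * x \<le> x powr \<beta> * lam"
        using x by (simp add: arith_mean_def distrib_left mult.left_commute[of "x powr \<beta>"]
            flip: powr_add)
      then have "inverse lam * ((1 - \<alpha>) + \<alpha> * x) \<le> inverse lam * (x powr \<beta> * lam)"
        using \<open>lam > 0\<close> by (intro mult_left_mono) auto
      moreover have "inverse lam * (x powr \<beta> * lam) = x powr \<beta>"
        using \<open>lam > 0\<close> by simp
      ultimately show ?thesis by (simp only: distrib_left mult.assoc)
    qed
    then have "cfc ?f T \<le>\<^sub>o\<^sub>p cfc (\<lambda>x. x powr \<beta>) T"
      by (intro cfc_mono f c\<beta>)
    from op_le_sandwich[OF root(1) this self_adjoint_cfc[OF f] self_adjoint_cfc[OF c\<beta>]]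
    have "X o\<^sub>L cfc ?f T o\<^sub>L X \<le>\<^sub>o\<^sub>p A \<sharp>\<^bsub>\<beta>\<^esub> B"
      by (simp only: geo)
    also have "X o\<^sub>L cfc ?f T o\<^sub>L X = inverse lam *\<^sub>R (A \<nabla>\<^bsub>\<alpha>\<^esub> B)"
      unfolding cfc_linear
      by (simp add: arith_mean_def B_eq root(4)[symmetric] comp.add_left comp.add_right
          comp.scaleR_left comp.scaleR_right scaleR_add_right)
    finally show ?thesis .
  qed
  moreover have "A \<sharp>\<^bsub>\<beta>\<^esub> B \<le>\<^sub>o\<^sub>p \<mu> *\<^sub>R (A !\<^bsub>\<alpha>\<^esub> B)"
  proof -
    \<comment> \<open>Scalar inequality \<open>x\<^sup>\<beta> \<le> \<mu> / ((1 - \<alpha>) + \<alpha> / x)\<close>; the quotient is \<open>\<mu>\<close> times the harmonic mean of \<open>1\<close> and \<open>x\<close>.\<close>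
    let ?l = "\<lambda>x. (1 - \<alpha>) + \<alpha> * inverse x"
    have l_pos: "?l x > 0" if "x \<in> {s..t}" for x
      using powr_mean_pos[OF assms(3), of x 0 "-1"] that assms(5)
      by (simp add: arith_mean_def powr_minus)
    have ci: "continuous_on {s..t} inverse"
      using assms(5) by (intro continuous_intros) auto
    have cl: "continuous_on {s..t} ?l"
      by (intro continuous_intros ci)
    have cr: "continuous_on {s..t} (\<lambda>x. inverse (?l x))"
      using l_pos by (intro continuous_on_inverse cl) force
    have c\<mu>: "continuous_on {s..t} (\<lambda>x. \<mu> * inverse (?l x))"
      by (intro continuous_intros cr)
    define T' where "T' = cfc inverse T"
    define R where "R = cfc (\<lambda>x. inverse (?l x)) T"
    have "is_op_inverse (cfc (\<lambda>x. x) T) (cfc (\<lambda>x. inverse x) T)"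
      using assms(5) by (intro is_op_inverse_cfc continuous_intros) auto
    then have T': "is_op_inverse T T'"
      by (simp add: cfc_ident T'_def)
    have "is_op_inverse (cfc ?l T) R"
      unfolding R_def using l_pos by (intro is_op_inverse_cfc cl) force
    moreover have "cfc ?l T = (1 - \<alpha>) *\<^sub>R id_blinfun + \<alpha> *\<^sub>R T'"
      using cfc_add[of "\<lambda>x. 1 - \<alpha>" "\<lambda>x. \<alpha> * inverse x"]
      by (simp add: cfc_const cfc_cmult ci continuous_intros T'_def)
    ultimately have R: "A !\<^bsub>\<alpha>\<^esub> B = X o\<^sub>L R o\<^sub>L X"
      using harm_mean_congruence[of X Y T T' \<alpha> R] root T'
      by (simp add: B_eq self_adjoint_def)
    have "x powr \<beta> \<le> \<mu> * inverse (?l x)" if "x \<in> {s..t}" for x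
    proof -
      have x: "x > 0" using that assms(5) by simp
      have "x powr \<beta> \<nabla>\<^bsub>\<alpha>\<^esub> x powr (-(1 - \<beta>)) \<le> \<mu>"
        unfolding assms(11) by (rule powr_mean_le_endpoints[OF assms(3,5) that])
      moreover have "x powr (-(1 - \<beta>)) = x powr \<beta> * inverse x"
        using x powr_add[of x \<beta> "-1"] by (simp add: powr_minus)
      ultimately have "x powr \<beta> * ?l x \<le> \<mu>"
        by (simp add: arith_mean_def algebra_simps)
      with l_pos[OF that] show ?thesis
        by (simp only: pos_le_divide_eq flip: divide_inverse)
    qed
    then have "cfc (\<lambda>x. x powr \<beta>) T \<le>\<^sub>o\<^sub>p cfc (\<lambda>x. \<mu> * inverse (?l x)) T"
      by (intro cfc_mono c\<mu> c\<beta>)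
    from op_le_sandwich[OF root(1) this self_adjoint_cfc[OF c\<beta>] self_adjoint_cfc[OF c\<mu>]]
    show ?thesis
      by (simp only: geo R R_def cfc_cmult[OF cr] comp.scaleR_left comp.scaleR_right)
  qed
  ultimately show ?thesis ..
qed

end
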